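(* Let $G=(V,E)$ be a finite simple graph, and for each $u\in V$ let $C_u\subset \mathbb{F}_2^{\Gamma_G(u)}$ be a linear subspace, where $\Gamma_G(u)=\{v\in V: uv\in E\}$. For each $u \in V$ let $A_u$ be a parity check matrix of $C_u$, with columns $\{w_{uv}: v\in\Gamma_G(u)\}$, and let $L_u=\{A_u z: z\in\mathbb{F}_2^{\Gamma_G(u)}\}$ be its column space. Let $\mathcal{F}$ be the local system on $G$ (viewed as a simplicial complex of dimension at most $1$) given by $\mathcal{F}(u)=L_u$ for each vertex $u\in V$, $\mathcal{F}(uv)=\mathbb{F}_2$ for each edge $uv\in E$, and $\rho_u^{uv}:\mathcal{F}(uv)=\mathbb{F}_2\to\mathcal{F}(u)=L_u$, $\rho_u^{uv}(\epsilon)=\epsilon\, w_{uv}$ for each edge $uv\in E$ and each endpoint $u$ of it. Let $$\mathcal{C}=\mathcal{C}(G,\{C_u\}_{u\in V})=\{x=(x_{uv})_{uv\in E}\in\mathbb{F}_2^E : (x_{uv}: v\in\Gamma_G(u))\in C_u \text{ for all } u\in V\}$$ be the graph code. Then, under the identification of $C_1(G;\mathcal{F})=\bigoplus_{uv\in E}\mathbb{F}_2$ with $\mathbb{F}_2^E$ given by $\sum_{uv\in E}x_{uv}[uv]\mapsto (x_{uv})_{uv\in E}$, $$\mathcal{C}=H_1(G;\mathcal{F}).$$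
   Context: Parity check matrix: a matrix $A_u$ over $\mathbb{F}_2$ with columns $w_{uv}$ indexed by $v\in\Gamma_G(u)$ is a parity check matrix of $C_u$ if a vector $y=(y_v)_{v\in\Gamma_G(u)}\in\mathbb{F}_2^{\Gamma_G(u)}$ satisfies $y\in C_u$ if and only if $\sum_{v\in\Gamma_G(u)}y_v w_{uv}=0$. For an edge $uv=vu$, the vector $w_{uv}$ is a column of $A_u$, while $w_{vu}$ is a column of $A_v$. Local systems and homology: Let $X$ be a finite simplicial complex on a vertex set $V$ with a fixed linear order $\prec$, and let $X(k)$ be the set of its $k$-dimensional simplices. For $\sigma=\{v_0,\ldots,v_k\}\in X(k)$ with $v_0\prec\cdots\prec v_k$, write $\sigma=[v_0\ldots v_k]$, and let $\sigma_i=\sigma\setminus\{v_i\}$. A local system $\mathcal{F}$ on $X$ is an assignment of an abelian group $\mathcal{F}(\sigma)$ to each simplex $\sigma\in X$, together with homomorphisms $\rho_\sigma^\tau:\mathcal{F}(\tau)\to\mathcal{F}(\sigma)$ for each $\sigma\subset\tau$, such that $\rho_\sigma^\sigma$ is the identity and $\rho_\eta^\sigma\rho_\sigma^\tau=\rho_\eta^\tau$ whenever $\eta\subset\sigma\subset\tau$. Let $C_k(X;\mathcal{F})=\bigoplus_{\sigma\in X(k)}\mathcal{F}(\sigma)$, whose elements are written $c=\sum_{\sigma\in X(k)}a_\sigma\sigma$ with $a_\sigma\in\mathcal{F}(\sigma)$. The boundary map $\partial_k:C_k(X;\mathcal{F})\to C_{k-1}(X;\mathcal{F})$ is $$\partial_k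 c=\sum_{\sigma\in X(k)}\sum_{i=0}^k(-1)^i\rho_{\sigma_i}^\sigma(a_\sigma)\,\sigma_i .$$ The homology of the complex $C_*(X;\mathcal{F})$ is denoted $H_*(X;\mathcal{F})$. For a graph $G$ there are no simplices of dimension $2$, so $C_2(G;\mathcal{F})=0$ and $H_1(G;\mathcal{F})$ is the subspace $\ker\partial_1$ of $C_1(G;\mathcal{F})$. *)

theory Defs
  imports
    "HOL-Algebra.Product_Groups"
    "HOL-Algebra.Weak_Morphisms"
    "HOL-Library.Z2"
    "Jordan_Normal_Form.Matrix"
begin

section \<open>Simplicial complexes and local systems\<close>

definition simplicial_complex :: "'a set \<Rightarrow> 'a set set \<Rightarrow> bool" where
  "simplicial_complex V X \<longleftrightarrow>
     finite V \<and> (\<forall>\<sigma>\<in>X. \<sigma> \<noteq> {} \<and> \<sigma> \<subseteq> V) \<and> (\<forall>v\<in>V. {v} \<in> X) \<and>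
     (\<forall>\<tau>\<in>X. \<forall>\<sigma>. \<sigma> \<noteq> {} \<and> \<sigma> \<subseteq> \<tau> \<longrightarrow> \<sigma> \<in> X)"

text \<open>Dimensions are integers, so that the chain group in dimension \<open>-1\<close> exists and is trivial
  (the empty set is not a simplex).\<close>

definition simplices :: "'a set set \<Rightarrow> int \<Rightarrow> 'a set set" where
  "simplices X k = {\<sigma> \<in> X. int (card \<sigma>) = k + 1}"

text \<open>The list \<open>[v\<^sub>0, \<dots>, v\<^sub>k]\<close> of the vertices of a simplex in increasing order; \<open>r\<close> is the
  reflexive form of the linear order on the vertex set.\<close>

definition vertex_list :: "'a rel \<Rightarrow> 'a set \<Rightarrow> 'a list" where
  "vertex_list r \<sigma> =
     (THE vs. set vs = \<sigma> \<and> distinct vs \<and> sorted_wrt (\<lambda>u v. (u, v) \<in> r) vs)"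

definition face :: "'a rel \<Rightarrow> 'a set \<Rightarrow> nat \<Rightarrow> 'a set" where
  "face r \<sigma> i = \<sigma> - {vertex_list r \<sigma> ! i}"

text \<open>Abelian groups are commutative groups in the sense of HOL-Algebra, hence written
  multiplicatively: \<open>\<otimes>\<close> is the addition and \<open>\<one>\<close> is the zero element.
  \<open>\<rho> \<sigma> \<tau>\<close> is the map \<open>F \<tau> \<rightarrow> F \<sigma>\<close> for \<open>\<sigma> \<subseteq> \<tau>\<close>.\<close>

locale local_system =
  fixes V :: "'a set" and X :: "'a set set"
    and F :: "'a set \<Rightarrow> 'b monoid"
    and \<rho> :: "'a set \<Rightarrow> 'a set \<Rightarrow> 'b \<Rightarrow> 'b"
  assumes complex: "simplicial_complex V X"
    and group: "\<And>\<sigma>. \<sigma> \<in> X \<Longrightarrow> comm_group (F \<sigma>)"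
    and hom: "\<And>\<sigma> \<tau>. \<sigma> \<in> X \<Longrightarrow> \<tau> \<in> X \<Longrightarrow> \<sigma> \<subseteq> \<tau> \<Longrightarrow> \<rho> \<sigma> \<tau> \<in> hom (F \<tau>) (F \<sigma>)"
    and ident: "\<And>\<sigma> a. \<sigma> \<in> X \<Longrightarrow> a \<in> carrier (F \<sigma>) \<Longrightarrow> \<rho> \<sigma> \<sigma> a = a"
    and comp: "\<And>\<eta> \<sigma> \<tau> a. \<eta> \<in> X \<Longrightarrow> \<sigma> \<in> X \<Longrightarrow> \<tau> \<in> X \<Longrightarrow> \<eta> \<subseteq> \<sigma> \<Longrightarrow> \<sigma> \<subseteq> \<tau> \<Longrightarrow>
      a \<in> carrier (F \<tau>) \<Longrightarrow> \<rho> \<eta> \<sigma> (\<rho> \<sigma> \<tau> a) = \<rho> \<eta> \<tau> a"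

definition chain_group :: "'a set set \<Rightarrow> ('a set \<Rightarrow> 'b monoid) \<Rightarrow> int \<Rightarrow> ('a set \<Rightarrow> 'b) monoid" where
  "chain_group X F k = sum_group (simplices X k) F"

text \<open>The chain \<open>a \<sigma>\<close> in dimension \<open>k\<close>. If \<open>\<sigma>\<close> is not a \<open>k\<close>-simplex this is the zero chain, which
  happens below only for \<open>k = -1\<close>.\<close>

definition single_chain ::
    "'a set set \<Rightarrow> ('a set \<Rightarrow> 'b monoid) \<Rightarrow> int \<Rightarrow> 'b \<Rightarrow> 'a set \<Rightarrow> ('a set \<Rightarrow> 'b)" where
  "single_chain X F k a \<sigma> = (\<lambda>\<eta>\<in>simplices X k. if \<eta> = \<sigma> then a else \<one>\<^bsub>F \<eta>\<^esub>)"

text \<open>In additive notation: the sum of \<open>(-1)\<^sup>i \<rho>(c \<sigma>) \<sigma>\<^sub>i\<close> over the \<open>k\<close>-simplices \<open>\<sigma>\<close> and \<open>0 \<le> i \<le> k\<close>.\<close>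

definition boundary ::
    "'a rel \<Rightarrow> 'a set set \<Rightarrow> ('a set \<Rightarrow> 'b monoid) \<Rightarrow> ('a set \<Rightarrow> 'a set \<Rightarrow> 'b \<Rightarrow> 'b) \<Rightarrow>
     int \<Rightarrow> ('a set \<Rightarrow> 'b) \<Rightarrow> ('a set \<Rightarrow> 'b)" where
  "boundary r X F \<rho> k c =
     (\<Otimes>\<^bsub>chain_group X F (k - 1)\<^esub>\<sigma>\<in>simplices X k.
        \<Otimes>\<^bsub>chain_group X F (k - 1)\<^esub>i\<in>{..<card \<sigma>}.
          single_chain X F (k - 1)
            (\<rho> (face r \<sigma> i) \<sigma> (c \<sigma>) [^]\<^bsub>F (face r \<sigma> i)\<^esub> ((-1) ^ i :: int))
            (face r \<sigma> i))"

definition cycles ::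
    "'a rel \<Rightarrow> 'a set set \<Rightarrow> ('a set \<Rightarrow> 'b monoid) \<Rightarrow> ('a set \<Rightarrow> 'a set \<Rightarrow> 'b \<Rightarrow> 'b) \<Rightarrow>
     int \<Rightarrow> ('a set \<Rightarrow> 'b) set" where
  "cycles r X F \<rho> k =
     kernel (chain_group X F k) (chain_group X F (k - 1)) (boundary r X F \<rho> k)"

definition boundaries ::
    "'a rel \<Rightarrow> 'a set set \<Rightarrow> ('a set \<Rightarrow> 'b monoid) \<Rightarrow> ('a set \<Rightarrow> 'a set \<Rightarrow> 'b \<Rightarrow> 'b) \<Rightarrow>
     int \<Rightarrow> ('a set \<Rightarrow> 'b) set" where
  "boundaries r X F \<rho> k = boundary r X F \<rho> (k + 1) ` carrier (chain_group X F (k + 1))"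

definition homology ::
    "'a rel \<Rightarrow> 'a set set \<Rightarrow> ('a set \<Rightarrow> 'b monoid) \<Rightarrow> ('a set \<Rightarrow> 'a set \<Rightarrow> 'b \<Rightarrow> 'b) \<Rightarrow>
     int \<Rightarrow> ('a set \<Rightarrow> 'b) set monoid" where
  "homology r X F \<rho> k =
     (chain_group X F k)\<lparr>carrier := cycles r X F \<rho> k\<rparr> Mod boundaries r X F \<rho> k"


section \<open>Linear codes over the two-element field\<close>

definition F2 :: "bit ring" where
  "F2 = \<lparr>carrier = UNIV, monoid.mult = (*), one = 1, zero = 0, add = (+)\<rparr>"

text \<open>The space of vectors over \<open>F2\<close> with index set \<open>S\<close>. The ring multiplication that the record
  type contains besides the module structure is irrelevant.\<close>

definition F2_space :: "'i set \<Rightarrow> (bit, 'i \<Rightarrow> bit) module" where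
  "F2_space S =
     \<lparr>carrier = S \<rightarrow>\<^sub>E UNIV, monoid.mult = undefined, one = undefined,
      zero = (\<lambda>i\<in>S. 0), add = (\<lambda>x y. \<lambda>i\<in>S. x i + y i),
      smult = (\<lambda>a x. \<lambda>i\<in>S. a * x i)\<rparr>"

text \<open>A matrix with \<open>m\<close> rows and columns indexed by a set \<open>S\<close> is given by its columns
  \<open>w i\<close>, \<open>i \<in> S\<close>, which are vectors of dimension \<open>m\<close>.\<close>

definition mat_apply :: "nat \<Rightarrow> 'i set \<Rightarrow> ('i \<Rightarrow> bit vec) \<Rightarrow> ('i \<Rightarrow> bit) \<Rightarrow> bit vec" where
  "mat_apply m S w z = finsum_vec TYPE(bit) m (\<lambda>i. z i \<cdot>\<^sub>v w i) S"

definition column_space :: "nat \<Rightarrow> 'i set \<Rightarrow> ('i \<Rightarrow> bit vec) \<Rightarrow> bit vec set" where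
  "column_space m S w = mat_apply m S w ` carrier (F2_space S)"

definition parity_check_matrix ::
    "nat \<Rightarrow> 'i set \<Rightarrow> ('i \<Rightarrow> bit vec) \<Rightarrow> ('i \<Rightarrow> bit) set \<Rightarrow> bool" where
  "parity_check_matrix m S w C \<longleftrightarrow>
     (\<forall>i\<in>S. w i \<in> carrier_vec m) \<and>
     (\<forall>y\<in>carrier (F2_space S). y \<in> C \<longleftrightarrow> mat_apply m S w y = 0\<^sub>v m)"


section \<open>Graph codes\<close>

definition finite_simple_graph :: "'a set \<Rightarrow> 'a set set \<Rightarrow> bool" where
  "finite_simple_graph V E \<longleftrightarrow> finite V \<and> (\<forall>e\<in>E. e \<subseteq> V \<and> card e = 2)"

definition neighbours :: "'a set \<Rightarrow> 'a set set \<Rightarrow> 'a \<Rightarrow> 'a set" where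
  "neighbours V E u = {v \<in> V. {u, v} \<in> E}"

definition graph_complex :: "'a set \<Rightarrow> 'a set set \<Rightarrow> 'a set set" where
  "graph_complex V E = (\<lambda>u. {u}) ` V \<union> E"

definition graph_code :: "'a set \<Rightarrow> 'a set set \<Rightarrow> ('a \<Rightarrow> ('a \<Rightarrow> bit) set) \<Rightarrow> ('a set \<Rightarrow> bit) set" where
  "graph_code V E C =
     {x \<in> carrier (F2_space E). \<forall>u\<in>V. (\<lambda>v\<in>neighbours V E u. x {u, v}) \<in> C u}"

text \<open>The groups of the local system have to share one type, so they live in a tagged sum: scalars
  (on edges) are tagged by \<^const>\<open>Inl\<close> and vectors (on vertices) by \<^const>\<open>Inr\<close>. The group
  \<open>image_group f G\<close> is the copy of \<open>G\<close> along the injection \<open>f\<close>. The matrix at \<open>u\<close> has \<open>m u\<close> rows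
  and columns \<open>w u v\<close>.\<close>

definition code_groups ::
    "'a set \<Rightarrow> 'a set set \<Rightarrow> ('a \<Rightarrow> nat) \<Rightarrow> ('a \<Rightarrow> 'a \<Rightarrow> bit vec) \<Rightarrow> 'a set \<Rightarrow> (bit + bit vec) monoid" where
  "code_groups V E m w \<sigma> =
     (if \<sigma> \<in> E then image_group Inl (add_monoid F2)
      else let u = the_elem \<sigma> in
        image_group Inr
          ((monoid_vec TYPE(bit) (m u))\<lparr>carrier := column_space (m u) (neighbours V E u) (w u)\<rparr>))"

text \<open>For \<open>\<sigma> = {u}\<close> and \<open>\<tau> = {u, v}\<close> this sends the scalar \<open>\<epsilon>\<close> to \<open>\<epsilon> w\<^sub>u\<^sub>v\<close>.\<close>

definition code_map ::
    "('a \<Rightarrow> 'a \<Rightarrow> bit vec) \<Rightarrow> 'a set \<Rightarrow> 'a set \<Rightarrow> bit + bit vec \<Rightarrow> bit + bit vec" where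
  "code_map w \<sigma> \<tau> a =
     (if \<sigma> = \<tau> then a else Inr (projl a \<cdot>\<^sub>v w (the_elem \<sigma>) (the_elem (\<tau> - \<sigma>))))"

text \<open>The identification of 1-chains with vectors indexed by the edges.\<close>

definition edge_vector :: "'a set set \<Rightarrow> ('a set \<Rightarrow> bit + bit vec) \<Rightarrow> ('a set \<Rightarrow> bit)" where
  "edge_vector E c = (\<lambda>e\<in>E. projl (c e))"

end

theory Submission
  imports Defs
begin

text \<open>
  A 1-chain is a family of scalars \<open>x e\<close>, one for each edge. In the boundary of such a chain, the
  edge \<open>{u, v}\<close> contributes \<open>\<plusminus>x {u, v} w u v\<close> to the vertex \<open>u\<close>. The coefficients lie in vector spaces
  over the two-element field, so the signs, and with them the chosen order of the vertices,
  disappear. The coefficient of the boundary at \<open>u\<close> is therefore the matrix at \<open>u\<close> applied to the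
  restriction of \<open>x\<close> to the edges at \<open>u\<close> (\<open>boundary_vertex\<close>). It vanishes exactly if this
  restriction lies in the local code, because the matrix is a parity check matrix. Hence the
  1-cycles are the codewords (\<open>cycle_iff\<close>, \<open>edge_vector_cycles\<close>).

  A graph has no 2-simplices, so the only 1-boundary is zero and the homology classes in
  dimension 1 are the singletons of cycles (\<open>carrier_homology_1\<close>).

  The one computation is that of \<open>boundary_vertex\<close>. The boundary is a product in a direct sum of
  groups. For each vertex \<open>u\<close> and each row \<open>j\<close>, reading off the entry \<open>j\<close> of the coefficient at \<open>u\<close>
  is additive, which turns this product into an ordinary sum of scalars over the edges
  (\<open>additive_finprod\<close>); only the edges at \<open>u\<close> remain, and they correspond to the neighbours of \<open>u\<close>
  (\<open>bij_betw_neighbours\<close>).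
\<close>

section \<open>Abelian groups\<close>

text \<open>This moves a computation out of a group with explicit carrier into a type of scalars, where
  sums are unconditional. The target is a type class, so the map cannot be a homomorphism in
  the sense of \<^const>\<open>hom\<close>.\<close>

lemma (in comm_monoid) additive_finprod:
  fixes h :: "'a \<Rightarrow> 'c :: comm_monoid_add"
  assumes one: "h \<one> = 0"
    and mult: "\<And>x y. x \<in> carrier G \<Longrightarrow> y \<in> carrier G \<Longrightarrow> h (x \<otimes> y) = h x + h y"
    and f: "f \<in> A \<rightarrow> carrier G"
  shows "h (finprod G f A) = (\<Sum>a\<in>A. h (f a))"
  using f
proof (induction A rule: infinite_finite_induct)
  case (insert a A)
  then show ?case
    by (simp add: Pi_iff mult)
qed (simp_all add: one)

text \<open>The signs in the boundary map act trivially on coefficients that are their own inverses.\<close>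

lemma (in group) int_pow_sign_involution:
  assumes x: "x \<in> carrier G" and "x \<otimes> x = \<one>"
  shows "x [^] ((-1) ^ i :: int) = x"
proof -
  have "inv x = x"
    using assms by (intro inv_equality) auto
  then show ?thesis
    using x by (cases "even i") (auto simp: int_pow_neg)
qed

lemma comm_group_sum_group:
  assumes "\<And>i. i \<in> I \<Longrightarrow> comm_group (G i)"
  shows "comm_group (sum_group I G)"
proof -
  have grp: "\<And>i. i \<in> I \<Longrightarrow> group (G i)"
    using assms by (simp add: comm_group_def)
  show ?thesis
  proof (rule group.group_comm_groupI)
    show "group (sum_group I G)"
      using grp by simp
  next
    fix x y assume "x \<in> carrier (sum_group I G)" "y \<in> carrier (sum_group I G)"
    then have "x i \<in> carrier (G i)" "y i \<in> carrier (G i)" if "i \<in> I" for i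
      using that by (auto simp: carrier_sum_group grp)
    then show "x \<otimes>\<^bsub>sum_group I G\<^esub> y = y \<otimes>\<^bsub>sum_group I G\<^esub> x"
      using assms by (auto intro!: restrict_ext comm_monoid.m_comm simp: comm_group_def)
  qed
qed

lemma comm_group_image_group:
  assumes G: "comm_group G" and inj: "inj_on f (carrier G)"
  shows "comm_group (image_group f G)"
proof -
  interpret comm_group G by fact
  have "group (image_group f G)"
    using inj by (rule inj_imp_image_group_is_group)
  then show ?thesis
    using inj
    by (intro group.group_comm_groupI) (auto simp: image_group_def m_comm)
qed

lemma bit_vec_add_self:
  fixes x :: "bit vec"
  assumes "x \<in> carrier_vec n"
  shows "x + x = 0\<^sub>v n"
  using assms by (intro eq_vecI) (auto simp flip: mult_2)


section \<open>Column spaces\<close>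

lemma mat_apply_carrier:
  assumes "\<And>i. i \<in> S \<Longrightarrow> w i \<in> carrier_vec m"
  shows "mat_apply m S w z \<in> carrier_vec m"
  unfolding mat_apply_def using assms by (intro finsum_vec_closed) auto

lemma index_mat_apply:
  assumes "finite S" "\<And>i. i \<in> S \<Longrightarrow> w i \<in> carrier_vec m" "j < m"
  shows "mat_apply m S w z $ j = (\<Sum>i\<in>S. z i * w i $ j)"
proof -
  have "mat_apply m S w z $ j = (\<Sum>i\<in>S. (z i \<cdot>\<^sub>v w i) $ j)"
    unfolding mat_apply_def using assms by (intro index_finsum_vec) auto
  also have "\<dots> = (\<Sum>i\<in>S. z i * w i $ j)"
  proof (rule sum.cong[OF refl])
    fix i assume "i \<in> S"
    then show "(z i \<cdot>\<^sub>v w i) $ j = z i * w i $ j"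
      using assms by (intro index_smult_vec) (metis carrier_vecD)
  qed
  finally show ?thesis .
qed

text \<open>Members of \<^const>\<open>F2_space\<close> are undefined outside the index set, while sums are more easily
  formed from arbitrary functions; the difference does not matter to the matrix.\<close>

lemma mat_apply_restrict:
  assumes "finite S" "\<And>i. i \<in> S \<Longrightarrow> w i \<in> carrier_vec m"
  shows "mat_apply m S w (restrict z S) = mat_apply m S w z"
proof (rule eq_vecI)
  show "dim_vec (mat_apply m S w (restrict z S)) = dim_vec (mat_apply m S w z)"
    using assms by (metis mat_apply_carrier carrier_vecD)
next
  fix j assume "j < dim_vec (mat_apply m S w z)"
  then have "j < m"
    using assms by (metis mat_apply_carrier carrier_vecD)
  then show "mat_apply m S w (restrict z S) $ j = mat_apply m S w z $ j"
    using assms by (simp add: index_mat_apply)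
qed

lemma mat_apply_in_column_space:
  assumes "finite S" "\<And>i. i \<in> S \<Longrightarrow> w i \<in> carrier_vec m"
  shows "mat_apply m S w z \<in> column_space m S w"
  unfolding column_space_def
  by (rule image_eqI[where x = "restrict z S"])
    (simp_all add: mat_apply_restrict assms F2_space_def)

lemma column_space_carrier:
  assumes "\<And>i. i \<in> S \<Longrightarrow> w i \<in> carrier_vec m" "x \<in> column_space m S w"
  shows "x \<in> carrier_vec m"
  using assms by (auto simp: column_space_def mat_apply_carrier)

lemma column_space_add:
  assumes S: "finite S" "\<And>i. i \<in> S \<Longrightarrow> w i \<in> carrier_vec m"
    and "x \<in> column_space m S w" "y \<in> column_space m S w"
  shows "x + y \<in> column_space m S w"
proof -
  obtain a b where x: "x = mat_apply m S w a" and y: "y = mat_apply m S w b"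
    using assms by (auto simp: column_space_def)
  have carrier: "mat_apply m S w z \<in> carrier_vec m" for z
    using S(2) by (rule mat_apply_carrier)
  have "x + y = mat_apply m S w (\<lambda>i. a i + b i)"
    unfolding x y
  proof (rule eq_vecI)
    show "dim_vec (mat_apply m S w a + mat_apply m S w b) =
        dim_vec (mat_apply m S w (\<lambda>i. a i + b i))"
      by (metis carrier carrier_vecD index_add_vec(2))
    fix j assume "j < dim_vec (mat_apply m S w (\<lambda>i. a i + b i))"
    then have j: "j < m"
      by (metis carrier carrier_vecD)
    then have "j < dim_vec (mat_apply m S w b)"
      by (metis carrier carrier_vecD)
    then show "(mat_apply m S w a + mat_apply m S w b) $ j = mat_apply m S w (\<lambda>i. a i + b i) $ j"
      by (simp only: index_add_vec(1) index_mat_apply[OF S j] distrib_right sum.distrib)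
  qed
  then show ?thesis
    using mat_apply_in_column_space[OF S] by simp
qed

text \<open>A multiple of a column is the image of a multiple of a unit vector. This makes the maps from an
  edge to its endpoints land in the column spaces.\<close>

lemma smult_column_in_column_space:
  assumes S: "finite S" "\<And>i. i \<in> S \<Longrightarrow> w i \<in> carrier_vec m" and i: "i \<in> S"
  shows "a \<cdot>\<^sub>v w i \<in> column_space m S w"
proof -
  have [simp]: "dim_vec (w i) = m"
    using S i by (metis carrier_vecD)
  let ?M = "mat_apply m S w (\<lambda>k. if k = i then a else 0)"
  have M: "?M \<in> carrier_vec m"
    using S(2) by (rule mat_apply_carrier)
  have "a \<cdot>\<^sub>v w i = ?M"
  proof (rule eq_vecI)
    show "dim_vec (a \<cdot>\<^sub>v w i) = dim_vec ?M"
      using M by simp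
    fix j assume "j < dim_vec ?M"
    then have j: "j < m"
      using M by simp
    have "?M $ j = (\<Sum>k\<in>S. (if k = i then a else 0) * w k $ j)"
      by (simp only: index_mat_apply[OF S j])
    also have "\<dots> = (\<Sum>k\<in>S. if k = i then a * w i $ j else 0)"
      by (intro sum.cong refl) (simp only: mult_zero_left split: if_split, blast)
    also have "\<dots> = a * w i $ j"
      by (simp only: sum.delta[OF S(1)] i if_True)
    also have "\<dots> = (a \<cdot>\<^sub>v w i) $ j"
      using j by (intro index_smult_vec(1)[symmetric]) simp
    finally show "(a \<cdot>\<^sub>v w i) $ j = ?M $ j" by (rule sym)
  qed
  then show ?thesis
    using mat_apply_in_column_space[OF S] by simp
qed

lemma zero_in_column_space:
  assumes S: "finite S" "\<And>i. i \<in> S \<Longrightarrow> w i \<in> carrier_vec m"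
  shows "0\<^sub>v m \<in> column_space m S w"
proof -
  have "mat_apply m S w (\<lambda>i. 0) \<in> carrier_vec m"
    using S(2) by (auto intro!: mat_apply_carrier)
  then have "0\<^sub>v m = mat_apply m S w (\<lambda>i. 0)"
    by (intro eq_vecI) (auto simp: index_mat_apply S)
  then show ?thesis
    using mat_apply_in_column_space[OF S] by simp
qed

text \<open>Closure under addition suffices: over the two-element field every vector is its own
  inverse.\<close>

lemma comm_group_column_space:
  assumes S: "finite S" "\<And>i. i \<in> S \<Longrightarrow> w i \<in> carrier_vec m"
  shows "comm_group ((monoid_vec TYPE(bit) m)\<lparr>carrier := column_space m S w\<rparr>)"
proof (rule comm_groupI, goal_cases)
  case (6 x)
  then show ?case
    using bit_vec_add_self[of x m] column_space_carrier[of S w m x] S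
    by (auto simp: monoid_vec_def)
next
  case (3 x y z)
  then show ?case
    using column_space_carrier[of S w m] S by (auto simp: monoid_vec_def intro!: assoc_add_vec)
next
  case (4 x y)
  then show ?case
    using column_space_carrier[of S w m] S by (auto simp: monoid_vec_def intro!: comm_add_vec)
qed (use column_space_carrier[of S w m] S in \<open>auto simp: monoid_vec_def column_space_add zero_in_column_space\<close>)


section \<open>The local system of a graph code\<close>

locale graph_with_columns =
  fixes V :: "'a set" and E :: "'a set set"
    and m :: "'a \<Rightarrow> nat" and w :: "'a \<Rightarrow> 'a \<Rightarrow> bit vec"
  assumes graph: "finite_simple_graph V E"
    and columns: "\<And>u v. u \<in> V \<Longrightarrow> v \<in> neighbours V E u \<Longrightarrow> w u v \<in> carrier_vec (m u)"
begin

abbreviation "X \<equiv> graph_complex V E"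
abbreviation "F \<equiv> code_groups V E m w"
abbreviation "\<rho> \<equiv> code_map w"
abbreviation "N \<equiv> neighbours V E"
abbreviation "L u \<equiv> column_space (m u) (N u) (w u)"

lemma finite_V: "finite V"
  using graph by (simp add: finite_simple_graph_def)

lemma finite_E: "finite E"
proof (rule finite_subset)
  show "E \<subseteq> Pow V"
    using graph by (auto simp: finite_simple_graph_def)
qed (simp add: finite_V)

lemma finite_neighbours: "finite (N u)"
  using finite_V by (simp add: neighbours_def)

lemma edgeE:
  assumes "e \<in> E"
  obtains u v where "e = {u, v}" "u \<noteq> v" "u \<in> V" "v \<in> V"
  using assms graph by (fastforce simp: finite_simple_graph_def card_2_iff)

lemma singleton_not_edge [simp]: "{u} \<notin> E"
  using graph by (force simp: finite_simple_graph_def)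

lemma edge_sub_edge: "e \<in> E \<Longrightarrow> e' \<in> E \<Longrightarrow> e \<subseteq> e' \<Longrightarrow> e = e'"
  using graph finite_subset[OF _ finite_V, of e'] card_subset_eq[of e' e]
  by (simp add: finite_simple_graph_def)

lemma not_self_neighbour: "u \<notin> N u"
  by (simp add: neighbours_def)

lemma bij_betw_neighbours: "bij_betw (\<lambda>v. {u, v}) (N u) {e \<in> E. u \<in> e}"
  unfolding bij_betw_def
proof
  show "inj_on (\<lambda>v. {u, v}) (N u)"
    by (auto simp: inj_on_def doubleton_eq_iff)
  show "(\<lambda>v. {u, v}) ` N u = {e \<in> E. u \<in> e}"
  proof (intro equalityI subsetI)
    fix e assume "e \<in> {e \<in> E. u \<in> e}"
    then have e: "e \<in> E" "u \<in> e"
      by auto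
    obtain v where "v \<in> V" "e = {u, v}"
      using e by (cases rule: edgeE) (auto simp: insert_commute)
    then show "e \<in> (\<lambda>v. {u, v}) ` N u"
      using e(1) by (auto simp: neighbours_def)
  qed (auto simp: neighbours_def)
qed

lemma simplices_1: "simplices X 1 = E"
  using graph by (auto simp: simplices_def graph_complex_def finite_simple_graph_def)

lemma simplices_0: "simplices X 0 = (\<lambda>u. {u}) ` V"
  using graph by (auto simp: simplices_def graph_complex_def finite_simple_graph_def)

lemma simplices_2: "simplices X 2 = {}"
  using graph by (auto simp: simplices_def graph_complex_def finite_simple_graph_def)

lemma simplicial_complex_graph: "simplicial_complex V X"
  unfolding simplicial_complex_def
proof (intro conjI ballI allI impI)
  fix \<sigma> assume "\<sigma> \<in> X"
  then show "\<sigma> \<noteq> {}" "\<sigma> \<subseteq> V"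
    by (auto simp: graph_complex_def elim: edgeE)
next
  fix \<tau> \<sigma> assume \<tau>: "\<tau> \<in> X" and \<sigma>: "\<sigma> \<noteq> {} \<and> \<sigma> \<subseteq> \<tau>"
  show "\<sigma> \<in> X"
  proof (cases "\<tau> \<in> E")
    case True
    then obtain u v where uv: "\<tau> = {u, v}" "u \<in> V" "v \<in> V"
      by (rule edgeE)
    then have "\<sigma> = {u} \<or> \<sigma> = {v} \<or> \<sigma> = \<tau>"
      using \<sigma> by blast
    then show ?thesis
      using uv \<tau> by (auto simp: graph_complex_def)
  next
    case False
    then show ?thesis
      using \<tau> \<sigma> by (auto simp: graph_complex_def subset_singleton_iff)
  qed
qed (use finite_V in \<open>auto simp: graph_complex_def\<close>)

lemma F_edge: "e \<in> E \<Longrightarrow> F e = image_group Inl (add_monoid F2)"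
  by (simp add: code_groups_def)

lemma F_vertex:
  "F {u} = image_group Inr ((monoid_vec TYPE(bit) (m u))\<lparr>carrier := L u\<rparr>)"
  by (simp add: code_groups_def Let_def)

lemma carrier_F_edge: "e \<in> E \<Longrightarrow> carrier (F e) = range Inl"
  by (simp add: F_edge image_group_def F2_def)

lemma one_F_edge: "e \<in> E \<Longrightarrow> \<one>\<^bsub>F e\<^esub> = Inl 0"
  by (simp add: F_edge image_group_def F2_def)

lemma mult_F_edge: "e \<in> E \<Longrightarrow> Inl a \<otimes>\<^bsub>F e\<^esub> Inl b = Inl (a + b)"
  by (simp add: F_edge image_group_def F2_def)

lemma carrier_F_vertex: "carrier (F {u}) = Inr ` L u"
  by (simp add: F_vertex image_group_def)

lemma one_F_vertex: "\<one>\<^bsub>F {u}\<^esub> = Inr (0\<^sub>v (m u))"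
  by (simp add: F_vertex image_group_def monoid_vec_def)

lemma mult_F_vertex:
  "a \<in> L u \<Longrightarrow> b \<in> L u \<Longrightarrow> Inr a \<otimes>\<^bsub>F {u}\<^esub> Inr b = Inr (a + b)"
  by (simp add: F_vertex image_group_def monoid_vec_def)

lemma comm_group_F:
  assumes "\<sigma> \<in> X"
  shows "comm_group (F \<sigma>)"
proof (cases "\<sigma> \<in> E")
  case True
  have "comm_group (add_monoid F2)"
    by (rule comm_groupI) (auto simp: F2_def add.assoc add.commute intro: exI[of _ "- _"])
  then show ?thesis
    using True by (simp add: F_edge comm_group_image_group)
next
  case False
  then obtain u where u: "u \<in> V" "\<sigma> = {u}"
    using assms by (auto simp: graph_complex_def)
  show ?thesis
    unfolding u F_vertex
    using columns[OF u(1)] finite_neighbours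
    by (intro comm_group_image_group comm_group_column_space) auto
qed

lemma map_vertex_edge:
  assumes "v \<in> N u"
  shows "\<rho> {u} {u, v} (Inl a) = Inr (a \<cdot>\<^sub>v w u v)"
proof -
  have "v \<noteq> u"
    using assms not_self_neighbour by blast
  then have "{u} \<noteq> {u, v}" "{u, v} - {u} = {v}"
    by auto
  then show ?thesis
    by (simp only: code_map_def if_False the_elem_eq sum.sel)
qed

lemma smult_column_in_L:
  assumes "u \<in> V" "v \<in> N u"
  shows "a \<cdot>\<^sub>v w u v \<in> L u"
  using assms columns finite_neighbours by (intro smult_column_in_column_space) auto

text \<open>All inclusions among simplices of a graph are trivial or go from a vertex to an edge. In
  particular no chain of inclusions has two proper steps, so the composition law of the local
  system reduces to the identity law.\<close>

lemma face_cases: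
  assumes "\<sigma> \<in> X" "\<tau> \<in> X" "\<sigma> \<subseteq> \<tau>"
  obtains "\<sigma> = \<tau>" | u v where "u \<in> V" "v \<in> N u" "\<sigma> = {u}" "\<tau> = {u, v}" "\<tau> \<in> E"
proof (cases "\<tau> \<in> E")
  case True
  show ?thesis
  proof (cases "\<sigma> \<in> E")
    case True
    then show ?thesis
      using assms \<open>\<tau> \<in> E\<close> edge_sub_edge that(1) by blast
  next
    case False
    then obtain u where u: "u \<in> V" "\<sigma> = {u}"
      using assms by (auto simp: graph_complex_def)
    obtain v where "\<tau> = {u, v}" "v \<in> V"
      using True assms u by (auto elim!: edgeE)
    then show ?thesis
      using that(2)[of u v] u True by (auto simp: neighbours_def)
  qed
next
  case False
  then have "\<sigma> = \<tau>"
    using assms by (auto simp: graph_complex_def elim: edgeE)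
  then show ?thesis by (rule that)
qed

lemma local_system: "local_system V X F \<rho>"
proof (rule local_system.intro)
  show "simplicial_complex V X"
    by (rule simplicial_complex_graph)
  show "comm_group (F \<sigma>)" if "\<sigma> \<in> X" for \<sigma>
    using that by (rule comm_group_F)
  show "\<rho> \<sigma> \<tau> \<in> hom (F \<tau>) (F \<sigma>)" if "\<sigma> \<in> X" "\<tau> \<in> X" "\<sigma> \<subseteq> \<tau>" for \<sigma> \<tau>
    using that
  proof (cases rule: face_cases)
    case 1
    then show ?thesis
      by (simp add: code_map_def hom_def)
  next
    case (2 u v)
    show ?thesis
    proof (rule homI)
      fix a assume "a \<in> carrier (F \<tau>)"
      then show "\<rho> \<sigma> \<tau> a \<in> carrier (F \<sigma>)"
        using 2 by (auto simp: carrier_F_edge carrier_F_vertex map_vertex_edge smult_column_in_L)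
    next
      fix a b assume "a \<in> carrier (F \<tau>)" "b \<in> carrier (F \<tau>)"
      then show "\<rho> \<sigma> \<tau> (a \<otimes>\<^bsub>F \<tau>\<^esub> b) = \<rho> \<sigma> \<tau> a \<otimes>\<^bsub>F \<sigma>\<^esub> \<rho> \<sigma> \<tau> b"
        using 2 by (auto simp only: carrier_F_edge mult_F_edge mult_F_vertex map_vertex_edge
            smult_column_in_L add_smult_distrib_vec)
    qed
  qed
  show "\<rho> \<sigma> \<sigma> a = a" for \<sigma> a
    by (simp add: code_map_def)
  show "\<rho> \<eta> \<sigma> (\<rho> \<sigma> \<tau> a) = \<rho> \<eta> \<tau> a"
    if "\<eta> \<in> X" "\<sigma> \<in> X" "\<tau> \<in> X" "\<eta> \<subseteq> \<sigma>" "\<sigma> \<subseteq> \<tau>" for \<eta> \<sigma> \<tau> a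
  proof -
    have "\<sigma> = \<tau> \<or> \<eta> = \<sigma>"
      using that(1,2,4)
    proof (cases rule: face_cases)
      case (2 u v)
      from that(2,3,5) show ?thesis
      proof (cases rule: face_cases)
        case (2 u' v')
        with \<open>\<sigma> \<in> E\<close> show ?thesis by simp
      qed simp
    qed simp
    then show ?thesis
      by (auto simp: code_map_def)
  qed
qed


section \<open>Chains of a graph\<close>

lemma comm_group_chains: "comm_group (chain_group X F k)"
  unfolding chain_group_def
  by (rule comm_group_sum_group) (simp add: comm_group_F simplices_def)

text \<open>There are finitely many simplices, so the direct sum is the full product.\<close>

lemma carrier_chains:
  "carrier (chain_group X F k) = (\<Pi>\<^sub>E \<sigma>\<in>simplices X k. carrier (F \<sigma>))"
proof -
  have "finite (simplices X k)"
    using finite_V finite_E by (simp add: simplices_def graph_complex_def)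
  moreover have "group (F \<sigma>)" if "\<sigma> \<in> simplices X k" for \<sigma>
    using that comm_group_F by (simp add: simplices_def comm_group_def)
  ultimately show ?thesis
    by (simp add: chain_group_def carrier_sum_group)
qed

lemma single_chain_carrier:
  assumes "\<And>\<sigma>. \<sigma> \<in> simplices X k \<Longrightarrow> \<sigma> = \<eta> \<Longrightarrow> a \<in> carrier (F \<eta>)"
  shows "single_chain X F k a \<eta> \<in> carrier (chain_group X F k)"
proof -
  have "\<one>\<^bsub>F \<sigma>\<^esub> \<in> carrier (F \<sigma>)" if "\<sigma> \<in> simplices X k" for \<sigma>
    using that comm_group_F[of \<sigma>]
    by (simp add: simplices_def comm_group_def group_def monoid.one_closed)
  then show ?thesis
    using assms by (auto simp: carrier_chains single_chain_def)
qed

lemma edge_vector_iso: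
  "edge_vector E \<in> iso (chain_group X F 1) (add_monoid (F2_space E))"
proof (rule isoI)
  show "edge_vector E \<in> hom (chain_group X F 1) (add_monoid (F2_space E))"
  proof (rule homI)
    fix c d assume "c \<in> carrier (chain_group X F 1)" "d \<in> carrier (chain_group X F 1)"
    then have "c e \<in> carrier (F e)" "d e \<in> carrier (F e)" if "e \<in> E" for e
      using that by (auto simp: carrier_chains simplices_1)
    then have "projl (c e \<otimes>\<^bsub>F e\<^esub> d e) = projl (c e) + projl (d e)" if "e \<in> E" for e
      using that by (force simp only: carrier_F_edge mult_F_edge sum.sel)
    then show "edge_vector E (c \<otimes>\<^bsub>chain_group X F 1\<^esub> d) =
        edge_vector E c \<otimes>\<^bsub>add_monoid (F2_space E)\<^esub> edge_vector E d"
      by (simp add: edge_vector_def F2_space_def chain_group_def simplices_1 cong: restrict_cong)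
  qed (simp add: edge_vector_def F2_space_def)
  show "bij_betw (edge_vector E) (carrier (chain_group X F 1)) (carrier (add_monoid (F2_space E)))"
  proof (rule bij_betw_byWitness[where f' = "\<lambda>x. \<lambda>e\<in>E. Inl (x e)"])
    show "\<forall>c\<in>carrier (chain_group X F 1). (\<lambda>e\<in>E. Inl (edge_vector E c e)) = c"
    proof
      fix c assume "c \<in> carrier (chain_group X F 1)"
      then have c: "c \<in> E \<rightarrow>\<^sub>E range Inl"
        using PiE_cong[of E "\<lambda>e. carrier (F e)" "\<lambda>e. range Inl"] carrier_F_edge
        by (simp add: carrier_chains simplices_1)
      show "(\<lambda>e\<in>E. Inl (edge_vector E c e)) = c"
      proof
        fix e show "(\<lambda>e\<in>E. Inl (edge_vector E c e)) e = c e"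
          using c PiE_mem[OF c, of e] PiE_arb[OF c, of e] by (auto simp: edge_vector_def)
      qed
    qed
  qed (auto simp: F2_space_def edge_vector_def carrier_chains simplices_1 carrier_F_edge
      fun_eq_iff PiE_def extensional_def)
qed

end

section \<open>Boundary, cycles and codewords\<close>

lemma vertex_list_pair:
  assumes r: "linear_order_on V r" and pq: "p \<noteq> q" "(p, q) \<in> r"
  shows "vertex_list r {p, q} = [p, q]"
  unfolding vertex_list_def
proof (rule the_equality)
  show "set [p, q] = {p, q} \<and> distinct [p, q] \<and> sorted_wrt (\<lambda>u v. (u, v) \<in> r) [p, q]"
    using pq by simp
next
  fix vs assume vs: "set vs = {p, q} \<and> distinct vs \<and> sorted_wrt (\<lambda>u v. (u, v) \<in> r) vs"
  then have "length vs = 2"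
    using pq by (metis card_2_iff distinct_card)
  then obtain a b where ab: "vs = [a, b]"
    by (auto simp: length_Suc_conv numeral_2_eq_2)
  moreover have "(q, p) \<notin> r"
    using r pq by (auto simp: order_on_defs dest: antisymD)
  ultimately show "vs = [p, q]"
    using vs by (auto simp: doubleton_eq_iff)
qed

context graph_with_columns
begin

context
  fixes r :: "'a rel"
  assumes r: "linear_order_on V r"
begin

text \<open>The order on the vertices decides which endpoint is removed first. Everything below is
  symmetric in the two endpoints, so only the existence of a suitable labelling is kept.\<close>

lemma faces_edge:
  assumes "e \<in> E"
  obtains p q where "e = {p, q}" "p \<noteq> q" "p \<in> V" "q \<in> V"
    "face r e 0 = {q}" "face r e 1 = {p}"
proof -
  obtain a b where ab: "e = {a, b}" "a \<noteq> b" "a \<in> V" "b \<in> V"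
    using assms by (rule edgeE)
  then have "(a, b) \<in> r \<or> (b, a) \<in> r"
    using r by (simp add: linear_order_on_def total_on_def)
  then obtain p q where e: "e = {p, q}" "p \<noteq> q" "p \<in> V" "q \<in> V" "(p, q) \<in> r"
    using ab by (metis insert_commute)
  then have "vertex_list r e = [p, q]"
    using vertex_list_pair[OF r] by simp
  then have "face r e 0 = {q}" "face r e 1 = {p}"
    using e by (auto simp: face_def)
  with e that show ?thesis by blast
qed

text \<open>An edge contributes to the coefficient at \<open>u\<close> through the face that equals \<open>{u}\<close>, if there is one.
  Once the signs are gone its contribution is its scalar times a column of the matrix at \<open>u\<close>, and
  the sum of these over the edges at \<open>u\<close> is a matrix-vector product.\<close>

lemma boundary_vertex:
  assumes c: "c \<in> carrier (chain_group X F 1)"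
  shows "boundary r X F \<rho> 1 c \<in> carrier (chain_group X F 0)"
    and "u \<in> V \<Longrightarrow> boundary r X F \<rho> 1 c {u} =
      Inr (mat_apply (m u) (N u) (w u) (\<lambda>v\<in>N u. edge_vector E c {u, v}))"
proof -
  interpret C0: comm_group "chain_group X F 0"
    by (rule comm_group_chains)
  define t where "t e i = single_chain X F 0
      (\<rho> (face r e i) e (c e) [^]\<^bsub>F (face r e i)\<^esub> ((-1) ^ i :: int)) (face r e i)" for e i
  have c_edge: "c e = Inl (edge_vector E c e)" if "e \<in> E" for e
    using c that by (force simp: carrier_chains simplices_1 carrier_F_edge edge_vector_def)
  have boundary: "boundary r X F \<rho> 1 c = (\<Otimes>\<^bsub>chain_group X F 0\<^esub>e\<in>E.
      \<Otimes>\<^bsub>chain_group X F 0\<^esub>i\<in>{..<card e}. t e i)"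
    by (simp add: boundary_def t_def simplices_1)
  have card_edge: "card e = 2" if "e \<in> E" for e
    using that graph by (simp add: finite_simple_graph_def)
  \<comment> \<open>A face term without its sign: the coefficient has order two.\<close>
  have t_eq: "t e i = single_chain X F 0 (Inr (edge_vector E c e \<cdot>\<^sub>v w u v)) {u}"
    and t_closed: "t e i \<in> carrier (chain_group X F 0)"
    if e: "e \<in> E" "e = {u, v}" and u: "u \<in> V" "v \<in> V" and f: "face r e i = {u}" for e i u v
  proof -
    have v: "v \<in> N u"
      using e u by (simp add: neighbours_def)
    let ?x = "edge_vector E c e \<cdot>\<^sub>v w u v"
    have x: "?x \<in> L u"
      using u v by (simp add: smult_column_in_L)
    then have "?x + ?x = 0\<^sub>v (m u)"
      using u(1) v by (intro bit_vec_add_self) (simp add: columns)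
    then have "Inr ?x \<otimes>\<^bsub>F {u}\<^esub> Inr ?x = \<one>\<^bsub>F {u}\<^esub>"
      using x by (simp add: mult_F_vertex one_F_vertex)
    moreover have "group (F {u})"
      using comm_group_F[of "{u}"] u by (simp add: graph_complex_def comm_group_def)
    ultimately have pow: "Inr ?x [^]\<^bsub>F {u}\<^esub> ((-1) ^ i :: int) = Inr ?x"
      using x by (intro group.int_pow_sign_involution) (auto simp: carrier_F_vertex)
    have "\<rho> {u} e (c e) = Inr ?x"
      using c_edge[OF e(1)] map_vertex_edge[OF v] e(2) by simp
    then show t: "t e i = single_chain X F 0 (Inr ?x) {u}"
      by (simp add: t_def f pow)
    show "t e i \<in> carrier (chain_group X F 0)"
      unfolding t using x by (intro single_chain_carrier) (auto simp: carrier_F_vertex)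
  qed
  have closed: "t e i \<in> carrier (chain_group X F 0)" if "e \<in> E" "i < card e" for e i
    using \<open>e \<in> E\<close>
  proof (cases rule: faces_edge)
    case (1 p q)
    then show ?thesis
      using that card_edge[OF that(1)] t_closed[of e p q i] t_closed[of e q p i]
      by (cases i) (auto simp: insert_commute)
  qed
  then have inner_closed: "(\<Otimes>\<^bsub>chain_group X F 0\<^esub>i\<in>{..<card e}. t e i)
      \<in> carrier (chain_group X F 0)" if "e \<in> E" for e
    using that by (intro C0.finprod_closed) auto
  then show b_closed: "boundary r X F \<rho> 1 c \<in> carrier (chain_group X F 0)"
    unfolding boundary by (intro C0.finprod_closed) auto

  assume u: "u \<in> V"
  have u0: "{u} \<in> simplices X 0"
    using u by (simp add: simplices_0)
  have at_u: "d {u} \<in> Inr ` L u" if "d \<in> carrier (chain_group X F 0)" for d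
    using that u0 by (auto simp: carrier_chains carrier_F_vertex dest: PiE_mem)
  have L_carrier: "x \<in> carrier_vec (m u)" if "x \<in> L u" for x
    using that columns[OF u] by (rule column_space_carrier[rotated])
  have "boundary r X F \<rho> 1 c {u} = Inr (projr (boundary r X F \<rho> 1 c {u}))"
    using at_u[OF b_closed] by auto
  also have "projr (boundary r X F \<rho> 1 c {u}) =
      mat_apply (m u) (N u) (w u) (\<lambda>v\<in>N u. edge_vector E c {u, v})" (is "?b = ?M")
  \<comment> \<open>Comparing the entries in each row \<open>j\<close> leaves only sums of scalars.\<close>
  proof (rule eq_vecI)
    have M: "?M \<in> carrier_vec (m u)"
      using columns[OF u] by (rule mat_apply_carrier)
    moreover have "?b \<in> carrier_vec (m u)"
      using at_u[OF b_closed] L_carrier by auto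
    ultimately show "dim_vec ?b = dim_vec ?M"
      by simp
    fix j assume "j < dim_vec ?M"
    then have j: "j < m u"
      using M by simp
    define h where "h d = projr (d {u}) $ j" for d :: "'a set \<Rightarrow> bit + bit vec"
    have h_one: "h \<one>\<^bsub>chain_group X F 0\<^esub> = 0"
      using u0 j by (simp add: h_def chain_group_def one_F_vertex)
    have h_mult: "h (d \<otimes>\<^bsub>chain_group X F 0\<^esub> d') = h d + h d'"
      if d: "d \<in> carrier (chain_group X F 0)" and d': "d' \<in> carrier (chain_group X F 0)" for d d'
    proof -
      obtain x x' where x: "d {u} = Inr x" "x \<in> L u" and x': "d' {u} = Inr x'" "x' \<in> L u"
        using at_u[OF d] at_u[OF d'] by auto
      have "h (d \<otimes>\<^bsub>chain_group X F 0\<^esub> d') = (x + x') $ j"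
        using u0 x x' by (simp add: h_def chain_group_def mult_F_vertex)
      also have "\<dots> = x $ j + x' $ j"
        using j L_carrier[OF x'(2)] by (intro index_add_vec(1)) simp
      finally show ?thesis
        by (simp only: h_def x x' sum.sel)
    qed
    let ?g = "\<lambda>e. edge_vector E c e * w u (the_elem (e - {u})) $ j"
    have h_t: "h (t e i) = (if face r e i = {u} then ?g e else 0)"
      if e: "e \<in> E" "e = {a, b}" "a \<noteq> b" "a \<in> V" "b \<in> V" "face r e i = {a}" for e a b i
    proof (cases "a = u")
      case True
      then have "w u b \<in> carrier_vec (m u)" "e - {u} = {b}"
        using e u by (auto intro!: columns simp: neighbours_def)
      then show ?thesis
        using t_eq[OF e(1,2,4,5,6)] True u0 j e(6) by (simp add: h_def single_chain_def)
    next
      case False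
      then show ?thesis
        using t_eq[OF e(1,2,4,5,6)] u0 j e(6)
        by (simp add: h_def single_chain_def one_F_vertex)
    qed
    \<comment> \<open>At most one of the two faces of an edge is \<open>{u}\<close>.\<close>
    have inner: "(\<Sum>i<card e. h (t e i)) = (if u \<in> e then ?g e else 0)" if "e \<in> E" for e
      using that
    proof (cases rule: faces_edge)
      case (1 p q)
      have "(\<Sum>i<card e. h (t e i)) = h (t e 0) + h (t e 1)"
        by (simp add: card_edge[OF that] numeral_2_eq_2)
      also have "h (t e 0) = (if q = u then ?g e else 0)"
        using h_t[of e q p 0] that 1 by (simp only: insert_commute) auto
      also have "h (t e 1) = (if p = u then ?g e else 0)"
        using h_t[of e p q 1] that 1 by auto
      finally show ?thesis
        using 1(1,2) by (cases "p = u"; cases "q = u"; simp only: if_True if_False) auto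
    qed
    have "?b $ j = h (boundary r X F \<rho> 1 c)"
      by (simp add: h_def)
    also have "\<dots> = (\<Sum>e\<in>E. h (\<Otimes>\<^bsub>chain_group X F 0\<^esub>i\<in>{..<card e}. t e i))"
      unfolding boundary
      using inner_closed by (intro C0.additive_finprod h_one h_mult) auto
    also have "\<dots> = (\<Sum>e\<in>E. \<Sum>i<card e. h (t e i))"
      using closed by (intro sum.cong refl C0.additive_finprod h_one h_mult) auto
    also have "\<dots> = (\<Sum>e\<in>E. if u \<in> e then ?g e else 0)"
      by (intro sum.cong refl inner)
    also have "\<dots> = (\<Sum>e | e \<in> E \<and> u \<in> e. ?g e)"
      by (rule sum.inter_filter[OF finite_E, symmetric])
    also have "\<dots> = (\<Sum>v\<in>N u. ?g {u, v})"
      by (rule sum.reindex_bij_betw[OF bij_betw_neighbours, symmetric])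
    also have "\<dots> = (\<Sum>v\<in>N u. edge_vector E c {u, v} * w u v $ j)"
    proof (intro sum.cong refl)
      fix v assume "v \<in> N u"
      then have "{u, v} - {u} = {v}"
        using not_self_neighbour by auto
      then show "?g {u, v} = edge_vector E c {u, v} * w u v $ j"
        by (simp only: the_elem_eq)
    qed
    also have "\<dots> = ?M $ j"
      using columns[OF u] finite_neighbours j by (simp add: index_mat_apply)
    finally show "?b $ j = ?M $ j" .
  qed
  finally show "boundary r X F \<rho> 1 c {u} = Inr ?M" .
qed

lemma cycle_iff:
  "c \<in> cycles r X F \<rho> 1 \<longleftrightarrow> c \<in> carrier (chain_group X F 1) \<and>
    (\<forall>u\<in>V. mat_apply (m u) (N u) (w u) (\<lambda>v\<in>N u. edge_vector E c {u, v}) = 0\<^sub>v (m u))"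
proof (cases "c \<in> carrier (chain_group X F 1)")
  case True
  have "boundary r X F \<rho> 1 c = \<one>\<^bsub>chain_group X F 0\<^esub> \<longleftrightarrow>
      (\<forall>\<sigma>\<in>simplices X 0. boundary r X F \<rho> 1 c \<sigma> = \<one>\<^bsub>chain_group X F 0\<^esub> \<sigma>)"
    using boundary_vertex(1)[OF True] comm_group_chains[of 0]
    by (metis PiE_ext carrier_chains comm_group_def group.is_monoid monoid.one_closed)
  also have "\<dots> \<longleftrightarrow> (\<forall>u\<in>V. boundary r X F \<rho> 1 c {u} = Inr (0\<^sub>v (m u)))"
    by (simp add: simplices_0 chain_group_def one_F_vertex)
  finally show ?thesis
    using True by (simp add: cycles_def kernel_def boundary_vertex(2)[OF True])
qed (simp add: cycles_def kernel_def)

text \<open>The boundary of the only 2-chain is an empty product.\<close>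

lemma boundaries_1: "boundaries r X F \<rho> 1 = {\<one>\<^bsub>chain_group X F 1\<^esub>}"
proof -
  interpret C1: comm_group "chain_group X F 1"
    by (rule comm_group_chains)
  show ?thesis
    by (simp add: boundaries_def boundary_def simplices_2 carrier_chains)
qed

lemma carrier_homology_1: "carrier (homology r X F \<rho> 1) = (\<lambda>z. {z}) ` cycles r X F \<rho> 1"
proof -
  interpret C1: comm_group "chain_group X F 1"
    by (rule comm_group_chains)
  have "\<one>\<^bsub>chain_group X F 1\<^esub> \<otimes>\<^bsub>chain_group X F 1\<^esub> z = z" if "z \<in> cycles r X F \<rho> 1" for z
    using that by (intro C1.l_one) (simp add: cycles_def kernel_def)
  then show ?thesis
    by (auto simp: homology_def FactGroup_def RCOSETS_def r_coset_def boundaries_1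
        simp del: mult_sum_group one_sum_group)
qed

text \<open>Being a cycle is a condition at each vertex, and so is being a codeword; the parity check
  matrices make the two local conditions equivalent.\<close>

lemma edge_vector_cycles:
  assumes "\<And>u. u \<in> V \<Longrightarrow> parity_check_matrix (m u) (N u) (w u) (C u)"
  shows "edge_vector E ` cycles r X F \<rho> 1 = graph_code V E C"
proof -
  have local_check: "mat_apply (m u) (N u) (w u) (\<lambda>v\<in>N u. x {u, v}) = 0\<^sub>v (m u) \<longleftrightarrow>
      (\<lambda>v\<in>N u. x {u, v}) \<in> C u" if "u \<in> V" for u and x :: "'a set \<Rightarrow> bit"
    using assms[OF that] by (simp add: parity_check_matrix_def F2_space_def)
  have "edge_vector E ` carrier (chain_group X F 1) = carrier (F2_space E)"
    using edge_vector_iso by (simp add: iso_def bij_betw_def)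
  then have F2_space: "carrier (F2_space E) = edge_vector E ` carrier (chain_group X F 1)" ..
  have "graph_code V E C = edge_vector E ` {c \<in> carrier (chain_group X F 1).
      \<forall>u\<in>V. (\<lambda>v\<in>N u. edge_vector E c {u, v}) \<in> C u}"
    unfolding graph_code_def F2_space by auto
  also have "\<dots> = edge_vector E ` cycles r X F \<rho> 1"
    by (intro arg_cong[where f = "(`) (edge_vector E)"]) (auto simp: cycle_iff local_check)
  finally show ?thesis ..
qed

end

end

theorem proposition2p1:
  fixes V :: "'a set" and E :: "'a set set" and r :: "'a rel"
    and C :: "'a \<Rightarrow> ('a \<Rightarrow> bit) set"
    and m :: "'a \<Rightarrow> nat" and w :: "'a \<Rightarrow> 'a \<Rightarrow> bit vec"
  defines "X \<equiv> graph_complex V E"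
    and "F \<equiv> code_groups V E m w"
    and "\<rho> \<equiv> code_map w"
  assumes "finite_simple_graph V E"
    and "linear_order_on V r"
    and "\<And>u. u \<in> V \<Longrightarrow> submodule (C u) F2 (F2_space (neighbours V E u))"
    and "\<And>u. u \<in> V \<Longrightarrow> parity_check_matrix (m u) (neighbours V E u) (w u) (C u)"
  shows "local_system V X F \<rho> \<and>
    edge_vector E \<in> iso (chain_group X F 1) (add_monoid (F2_space E)) \<and>
    carrier (homology r X F \<rho> 1) = (\<lambda>z. {z}) ` cycles r X F \<rho> 1 \<and>
    edge_vector E ` cycles r X F \<rho> 1 = graph_code V E C"
proof -
  have checks: "parity_check_matrix (m u) (neighbours V E u) (w u) (C u)" if "u \<in> V" for u
    using that by fact
  interpret graph_with_columns V E m w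
  proof
    show "finite_simple_graph V E"
      by fact
    show "w u v \<in> carrier_vec (m u)" if "u \<in> V" "v \<in> neighbours V E u" for u v
      using checks[OF that(1)] that(2) unfolding parity_check_matrix_def by blast
  qed
  show ?thesis
    unfolding X_def F_def \<rho>_def
  proof (intro conjI)
    show "local_system V (graph_complex V E) (code_groups V E m w) (code_map w)"
      by (rule local_system)
    show "edge_vector E \<in> iso (chain_group (graph_complex V E) (code_groups V E m w) 1)
        (add_monoid (F2_space E))"
      by (rule edge_vector_iso)
    show "carrier (homology r (graph_complex V E) (code_groups V E m w) (code_map w) 1) =
        (\<lambda>z. {z}) ` cycles r (graph_complex V E) (code_groups V E m w) (code_map w) 1"
      using \<open>linear_order_on V r\<close> by (rule carrier_homology_1)
    show "edge_vector E ` cycles r (graph_complex V E) (code_groups V E m w) (code_map w) 1 =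
        graph_code V E C"
      using \<open>linear_order_on V r\<close> checks by (rule edge_vector_cycles)
  qed
qed

end
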